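(* Let $E$ be a normed space, let $f\colon E\to E$, and let $p\in[1,+\infty)$. Assume that the composition operator $C_f$ maps $c_0(E)$ into $bv_p(E)$. Then $C_f\colon c_0(E)\to bv_p(E)$ is continuous if and only if $f$ is continuous.
   Context: $E$ is a normed space over $\mathbb R$ or $\mathbb C$ with norm $\|\cdot\|$. For a map $f\colon E\to E$, the composition operator $C_f$ assigns to a sequence $x\colon\mathbb N\to E$ the sequence $C_f(x)$ with $C_f(x)(n)=f(x(n))$ for all $n\in\mathbb N$. $c_0(E)$ is the space of all $E$-valued sequences converging to $0$, with norm $\|x\|_\infty=\sup_n\|x(n)\|$. For $p\in[1,+\infty)$, $bv_p(E)$ is the space of all sequences $x\colon\mathbb N\to E$ with $\sum_{n=1}^\infty\|x(n+1)-x(n)\|^p<+\infty$, with norm $\|x\|_{bv_p}=\|x(1)\|+\bigl(\sum_{n=1}^\infty\|x(n+1)-x(n)\|^p\bigr)^{1/p}$. *)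

theory Defs
  imports "HOL-Analysis.Analysis"
begin

(* Sequences are functions nat => 'a and start at index 0, so x 0 plays the role of x(1).
   The class real_normed_vector also covers complex normed spaces: nothing below uses the
   scalar multiplication, only the norm and the additive structure. *)

definition c_zero :: "(nat \<Rightarrow> 'a::real_normed_vector) set" where
  "c_zero = {x. x \<longlonglongrightarrow> 0}"

definition sup_norm :: "(nat \<Rightarrow> 'a::real_normed_vector) \<Rightarrow> real" where
  "sup_norm x = (SUP n. norm (x n))"

definition bv_space :: "real \<Rightarrow> (nat \<Rightarrow> 'a::real_normed_vector) set" where
  "bv_space p = {x. summable (\<lambda>n. norm (x (Suc n) - x n) powr p)}"

definition bv_norm :: "real \<Rightarrow> (nat \<Rightarrow> 'a::real_normed_vector) \<Rightarrow> real" where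
  "bv_norm p x = norm (x 0) + (\<Sum>n. norm (x (Suc n) - x n) powr p) powr (1 / p)"

definition comp_op :: "('a \<Rightarrow> 'a) \<Rightarrow> (nat \<Rightarrow> 'a) \<Rightarrow> (nat \<Rightarrow> 'a)" where
  "comp_op f x = (\<lambda>n. f (x n))"

(* The value 0 outside S is immaterial for the topology on S; it is there because
   Metric_space demands a nonnegative distance on the whole type, where N may be
   unspecified (e.g. the supremum of an unbounded sequence). *)

definition norm_dist ::
    "(nat \<Rightarrow> 'a::real_normed_vector) set \<Rightarrow> ((nat \<Rightarrow> 'a) \<Rightarrow> real) \<Rightarrow> (nat \<Rightarrow> 'a) \<Rightarrow> (nat \<Rightarrow> 'a) \<Rightarrow> real"
  where "norm_dist S N x y = (if x \<in> S \<and> y \<in> S then N (\<lambda>n. x n - y n) else 0)"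

definition c_zero_topology :: "(nat \<Rightarrow> 'a::real_normed_vector) topology" where
  "c_zero_topology = Metric_space.mtopology c_zero (norm_dist c_zero sup_norm)"

definition bv_topology :: "real \<Rightarrow> (nat \<Rightarrow> 'a::real_normed_vector) topology" where
  "bv_topology p = Metric_space.mtopology (bv_space p) (norm_dist (bv_space p) (bv_norm p))"

(* Metric_space.mtopology is only meaningful for an actual metric, hence the facts
   Metric_space_c_zero and Metric_space_bv_space below. *)

lemma Metric_space_norm_dist:
  fixes S :: "(nat \<Rightarrow> 'a::real_normed_vector) set"
  assumes diff: "\<And>x y. x \<in> S \<Longrightarrow> y \<in> S \<Longrightarrow> (\<lambda>n. x n - y n) \<in> S"
    and nonneg: "\<And>x. x \<in> S \<Longrightarrow> 0 \<le> N x"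
    and uminus: "\<And>x. x \<in> S \<Longrightarrow> N (\<lambda>n. - x n) = N x"
    and zero: "\<And>x. x \<in> S \<Longrightarrow> N x = 0 \<longleftrightarrow> x = (\<lambda>n. 0)"
    and add: "\<And>x y. x \<in> S \<Longrightarrow> y \<in> S \<Longrightarrow> N (\<lambda>n. x n + y n) \<le> N x + N y"
  shows "Metric_space S (norm_dist S N)"
proof
  fix x y z :: "nat \<Rightarrow> 'a"
  show "0 \<le> norm_dist S N x y"
    using diff nonneg by (simp add: norm_dist_def)
  show "norm_dist S N x y = norm_dist S N y x"
    using uminus[OF diff, of x y] by (simp add: norm_dist_def)
  assume xy: "x \<in> S" "y \<in> S"
  show "norm_dist S N x y = 0 \<longleftrightarrow> x = y"
    using xy zero[OF diff[OF xy]] by (auto simp: norm_dist_def fun_eq_iff)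
  assume z: "z \<in> S"
  show "norm_dist S N x z \<le> norm_dist S N x y + norm_dist S N y z"
    using xy z add[OF diff[OF xy] diff[OF xy(2) z]] by (simp add: norm_dist_def)
qed

lemma c_zero_bdd:
  assumes "x \<in> c_zero"
  shows "bdd_above (range (\<lambda>n. norm (x n)))"
proof -
  have "Bseq x"
    using assms convergent_imp_Bseq convergentI unfolding c_zero_def by blast
  then show ?thesis
    by (auto simp: Bseq_def bdd_above_def)
qed

lemma norm_le_sup_norm:
  assumes "x \<in> c_zero"
  shows "norm (x n) \<le> sup_norm x"
  unfolding sup_norm_def by (rule cSUP_upper[OF _ c_zero_bdd[OF assms]]) simp

lemma Metric_space_c_zero: "Metric_space c_zero (norm_dist c_zero sup_norm)"
proof (rule Metric_space_norm_dist)
  fix x y :: "nat \<Rightarrow> 'a"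
  assume x: "x \<in> c_zero"
  show "0 \<le> sup_norm x"
    using norm_le_sup_norm[OF x, of 0] norm_ge_zero order_trans by blast
  show "sup_norm (\<lambda>n. - x n) = sup_norm x"
    by (simp add: sup_norm_def)
  show "sup_norm x = 0 \<longleftrightarrow> x = (\<lambda>n. 0)"
  proof
    assume "sup_norm x = 0"
    then show "x = (\<lambda>n. 0)"
      using norm_le_sup_norm[OF x] by (simp add: fun_eq_iff)
  qed (simp add: sup_norm_def)
  assume y: "y \<in> c_zero"
  show "(\<lambda>n. x n - y n) \<in> c_zero"
    using x y tendsto_diff[of x 0 sequentially y 0] by (simp add: c_zero_def)
  show "sup_norm (\<lambda>n. x n + y n) \<le> sup_norm x + sup_norm y"
    unfolding sup_norm_def[of "\<lambda>n. x n + y n"]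
    by (rule cSUP_least) (auto intro!: norm_triangle_le add_mono norm_le_sup_norm x y)
qed

lemma powr_convex_nonneg:
  fixes a b s t p :: real
  assumes "1 \<le> p" "0 \<le> a" "0 \<le> b" "0 \<le> s" "0 \<le> t" "s + t = 1"
  shows "(s * a + t * b) powr p \<le> s * a powr p + t * b powr p"
proof -
  have scale: "(u * c) powr p \<le> u * c powr p" if "0 \<le> u" "u \<le> 1" "0 \<le> c" for u c :: real
  proof -
    have "u powr p \<le> u"
      using that assms(1) powr_mono'[of 1 p u] by auto
    then show ?thesis
      using that by (simp add: powr_mult mult_right_mono)
  qed
  show ?thesis
  proof (cases "a = 0 \<or> b = 0")
    case True
    then show ?thesis
      using scale[of t b] scale[of s a] assms by auto
  next
    case False
    have s: "s = 1 - t"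
      using assms by simp
    show ?thesis
      using False convex_onD[OF powr_convex[OF assms(1)], of t a b] assms(2-5) unfolding s by auto
  qed
qed

lemma Minkowski_suminf:
  fixes a b c :: "nat \<Rightarrow> real"
  assumes p: "1 \<le> p" and a: "\<And>n. 0 \<le> a n" and b: "\<And>n. 0 \<le> b n"
    and c: "\<And>n. 0 \<le> c n" "\<And>n. c n \<le> a n + b n"
    and sa: "summable (\<lambda>n. a n powr p)" and sb: "summable (\<lambda>n. b n powr p)"
  shows "summable (\<lambda>n. c n powr p)"
    and "(\<Sum>n. c n powr p) powr (1 / p)
      \<le> (\<Sum>n. a n powr p) powr (1 / p) + (\<Sum>n. b n powr p) powr (1 / p)"
proof -
  define A where "A = (\<Sum>n. a n powr p) powr (1 / p)"
  define B where "B = (\<Sum>n. b n powr p) powr (1 / p)"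
  have Ap: "A powr p = (\<Sum>n. a n powr p)" and Bp: "B powr p = (\<Sum>n. b n powr p)"
    using p by (simp_all add: A_def B_def powr_powr suminf_nonneg sa sb)
  have mono: "c n powr p \<le> (a n + b n) powr p" for n
    using c p by (intro powr_mono2) auto
  have "summable (\<lambda>n. c n powr p) \<and> (\<Sum>n. c n powr p) \<le> (A + B) powr p"
  proof (cases "A = 0 \<or> B = 0")
    case True
    then have "(\<forall>n. a n = 0) \<or> (\<forall>n. b n = 0)"
      unfolding A_def B_def using suminf_eq_zero_iff[OF sa] suminf_eq_zero_iff[OF sb] by auto
    then show ?thesis
    proof
      assume "\<forall>n. a n = 0"
      then have le: "c n powr p \<le> b n powr p" and "A = 0" for n
        using mono[of n] by (auto simp: A_def)
      with sb have "summable (\<lambda>n. c n powr p)"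
        by (intro summable_comparison_test'[OF sb, of 0]) auto
      with suminf_le[OF le this sb] \<open>A = 0\<close> Bp show ?thesis by simp
    next
      assume "\<forall>n. b n = 0"
      then have le: "c n powr p \<le> a n powr p" and "B = 0" for n
        using mono[of n] by (auto simp: B_def)
      with sa have "summable (\<lambda>n. c n powr p)"
        by (intro summable_comparison_test'[OF sa, of 0]) auto
      with suminf_le[OF le this sa] \<open>B = 0\<close> Ap show ?thesis by simp
    qed
  next
    case False
    then have pos: "0 < A" "0 < B"
      by (auto simp: A_def B_def)
    define s where "s = A / (A + B)"
    define t where "t = B / (A + B)"
    define g where "g n = (A + B) powr p *
      (s / A powr p * a n powr p + t / B powr p * b n powr p)" for n
    have st: "0 \<le> s" "0 \<le> t" "s + t = 1"
      using pos by (auto simp: s_def t_def add_divide_distrib[symmetric])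
    have le: "c n powr p \<le> g n" for n
    proof -
      have "a n + b n = (A + B) * (s * (a n / A) + t * (b n / B))"
      proof -
        have "s * (a n / A) = a n / (A + B)" "t * (b n / B) = b n / (A + B)"
          using pos by (simp_all add: s_def t_def)
        then show ?thesis
          using pos by (simp add: add_divide_distrib[symmetric])
      qed
      then have "(a n + b n) powr p = (A + B) powr p * (s * (a n / A) + t * (b n / B)) powr p"
        using pos a[of n] b[of n] st by (simp add: powr_mult)
      also have "\<dots> \<le> (A + B) powr p * (s * (a n / A) powr p + t * (b n / B) powr p)"
        using pos a[of n] b[of n] st p by (intro mult_left_mono powr_convex_nonneg) auto
      also have "\<dots> = g n"
        using pos a[of n] b[of n] by (simp add: g_def powr_divide)
      finally show ?thesis
        using mono[of n] by simp
    qed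
    have "(\<lambda>n. g n) sums ((A + B) powr p * (s / A powr p * A powr p + t / B powr p * B powr p))"
      unfolding g_def Ap[symmetric] Bp[symmetric]
      by (intro sums_mult sums_add; simp only: Ap Bp summable_sums[OF sa] summable_sums[OF sb])
    then have g: "g sums ((A + B) powr p)"
      using pos st by simp
    have sc: "summable (\<lambda>n. c n powr p)"
      using le by (intro summable_comparison_test'[OF sums_summable[OF g], of 0]) auto
    then show ?thesis
      using suminf_le[OF le sc sums_summable[OF g]] sums_unique[OF g] by simp
  qed
  then have sc: "summable (\<lambda>n. c n powr p)" and le: "(\<Sum>n. c n powr p) \<le> (A + B) powr p"
    by auto
  show "summable (\<lambda>n. c n powr p)"
    by (rule sc)
  have "(\<Sum>n. c n powr p) powr (1 / p) \<le> ((A + B) powr p) powr (1 / p)"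
    using p le sc by (intro powr_mono2) (auto intro: suminf_nonneg)
  also have "\<dots> = A + B"
    using p by (simp add: powr_powr A_def B_def)
  finally show "(\<Sum>n. c n powr p) powr (1 / p)
      \<le> (\<Sum>n. a n powr p) powr (1 / p) + (\<Sum>n. b n powr p) powr (1 / p)"
    by (simp add: A_def B_def)
qed

lemma Metric_space_bv_space:
  assumes p: "1 \<le> p"
  shows "Metric_space (bv_space p) (norm_dist (bv_space p) (bv_norm p))"
proof (rule Metric_space_norm_dist)
  fix x y :: "nat \<Rightarrow> 'a"
  assume x: "x \<in> bv_space p"
  have sx: "summable (\<lambda>n. norm (x (Suc n) - x n) powr p)"
    using x by (simp add: bv_space_def)
  show "0 \<le> bv_norm p x"
    by (simp add: bv_norm_def)
  have "norm (- x (Suc n) + x n) = norm (x (Suc n) - x n)" for n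
    using norm_minus_commute[of "x n" "x (Suc n)"] by simp
  then show "bv_norm p (\<lambda>n. - x n) = bv_norm p x"
    by (simp add: bv_norm_def)
  show "bv_norm p x = 0 \<longleftrightarrow> x = (\<lambda>n. 0)"
  proof
    assume "bv_norm p x = 0"
    then have x0: "x 0 = 0" and "(\<Sum>n. norm (x (Suc n) - x n) powr p) = 0"
      by (simp_all add: bv_norm_def add_nonneg_eq_0_iff)
    then have step: "x (Suc n) = x n" for n
      using suminf_eq_zero_iff[OF sx] by auto
    have "x n = 0" for n
      by (induction n) (simp_all add: x0 step)
    then show "x = (\<lambda>n. 0)" by auto
  qed (simp add: bv_norm_def)
  assume y: "y \<in> bv_space p"
  have sy: "summable (\<lambda>n. norm (y (Suc n) - y n) powr p)"
    using y by (simp add: bv_space_def)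
  have le: "norm ((x (Suc n) - y (Suc n)) - (x n - y n)) \<le> norm (x (Suc n) - x n) + norm (y (Suc n) - y n)"
    "norm ((x (Suc n) + y (Suc n)) - (x n + y n)) \<le> norm (x (Suc n) - x n) + norm (y (Suc n) - y n)" for n
    using norm_triangle_ineq4[of "x (Suc n) - x n" "y (Suc n) - y n"]
      norm_triangle_ineq[of "x (Suc n) - x n" "y (Suc n) - y n"]
    by (simp_all add: algebra_simps)
  show "(\<lambda>n. x n - y n) \<in> bv_space p"
    using Minkowski_suminf(1)[OF p _ _ _ le(1) sx sy] by (simp add: bv_space_def)
  show "bv_norm p (\<lambda>n. x n + y n) \<le> bv_norm p x + bv_norm p y"
    using Minkowski_suminf(2)[OF p _ _ _ le(2) sx sy] norm_triangle_ineq[of "x 0" "y 0"]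
    by (simp add: bv_norm_def)
qed

end

theory Submission
  imports Defs
begin

text \<open>
  The hypothesis that \<open>f\<close> maps null sequences into \<open>bv_space p\<close> already forces \<open>f\<close> to be constant
  on a ball around \<open>0\<close>. Otherwise choose \<open>u k \<rightarrow> 0\<close> with \<open>f (u k) \<noteq> f 0\<close> and repeat each \<open>u k\<close> so
  often, always alternating with \<open>0\<close>, that the \<open>p\<close>-variation of the image diverges. Hence for
  \<open>y\<close> uniformly close to a null sequence \<open>x\<close>, the images of \<open>x\<close> and \<open>y\<close> agree from an index on that
  depends only on \<open>x\<close>, and continuity of \<open>f\<close> at finitely many points controls the rest. Conversely,
  \<open>f\<close> is recovered from the action of its composition operator on the sequences \<open>(u, 0, 0, \<dots>)\<close>.
\<close>

text \<open>However fast \<open>c\<close> decays, each index can be held long enough to keep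
  \<open>c (g n)\<close> above the harmonic sequence, whose divergence is used later. Take for
  \<open>g n\<close> the largest admissible \<open>k\<close>: every fixed \<open>k\<close> is
  eventually admissible because \<open>c k > 0\<close>, so these maxima tend to infinity.\<close>

lemma slow_reindexing:
  fixes c :: "nat \<Rightarrow> real"
  assumes c: "\<And>k. 0 < c k"
  obtains g where "filterlim g at_top sequentially"
    and "\<forall>\<^sub>F n in sequentially. inverse (real (Suc n)) \<le> c (g n)"
proof -
  \<comment> \<open>The cutoff \<open>k \<le> n\<close> keeps the set finite, so that its maximum
    exists.\<close>
  define S where "S n = {k. k \<le> n \<and> inverse (real (Suc n)) \<le> c k}" for n
  have fin: "finite (S n)" for n
    by (simp add: S_def)
  have mem: "\<forall>\<^sub>F n in sequentially. k \<in> S n" for k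
  proof -
    have "\<forall>\<^sub>F n in sequentially. inverse (real (Suc n)) < c k"
      using order_tendstoD(2)[OF LIMSEQ_inverse_real_of_nat c] .
    then show ?thesis
      using eventually_ge_at_top[of k] by eventually_elim (simp add: S_def)
  qed
  show ?thesis
  proof
    show "filterlim (\<lambda>n. Max (S n)) at_top sequentially"
      unfolding filterlim_at_top by (intro allI eventually_mono[OF mem] Max_ge[OF fin])
    show "\<forall>\<^sub>F n in sequentially. inverse (real (Suc n)) \<le> c (Max (S n))"
      using mem[of 0]
    proof eventually_elim
      case (elim n)
      then have "Max (S n) \<in> S n"
        using fin by (intro Max_in) auto
      then show ?case
        by (simp add: S_def)
    qed
  qed
qed

lemma comp_op_bv_space_imp_locally_constant:
  fixes f :: "'a::real_normed_vector \<Rightarrow> 'a"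
  assumes f: "comp_op f \<in> c_zero \<rightarrow> bv_space p"
  obtains r where "0 < r" and "\<And>u. norm u < r \<Longrightarrow> f u = f 0"
proof (rule ccontr)
  assume no_ball: "\<not> thesis"
  note ball = that
  have "\<exists>u. norm u < r \<and> f u \<noteq> f 0" if "0 < r" for r
    using no_ball ball[OF that] by auto
  then have "\<forall>k. \<exists>u. norm u < inverse (real (Suc k)) \<and> f u \<noteq> f 0"
    by simp
  then obtain u where u: "\<And>k. norm (u k) < inverse (real (Suc k))" "\<And>k. f (u k) \<noteq> f 0"
    by metis
  define c where "c k = norm (f (u k) - f 0) powr p" for k
  have "0 < c k" for k
    using u(2) by (simp add: c_def)
  then obtain g where g: "filterlim g at_top sequentially"
    and cg: "\<forall>\<^sub>F n in sequentially. inverse (real (Suc n)) \<le> c (g n)"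
    using slow_reindexing by blast
  have "u \<longlonglongrightarrow> 0"
    by (rule Lim_null_comparison[OF _ LIMSEQ_inverse_real_of_nat])
      (intro always_eventually allI less_imp_le u)
  then have ug: "(\<lambda>n. u (g n)) \<longlonglongrightarrow> 0"
    using g by (rule filterlim_compose)
  define x where "x n = (if even n then u (g n) else 0)" for n
  have "x \<longlonglongrightarrow> 0"
    by (rule Lim_null_comparison[OF _ tendsto_norm_zero[OF ug]]) (simp add: x_def)
  then have summ: "summable (\<lambda>n. norm (f (x (Suc n)) - f (x n)) powr p)"
    using f by (auto simp: c_zero_def bv_space_def comp_op_def Pi_iff)
  \<comment> \<open>Of two neighbouring indices exactly one is even, so the increment is
    \<open>c (g n)\<close> for even \<open>n\<close> and \<open>c (g (Suc n))\<close> for odd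
    \<open>n\<close>. The bound with \<open>Suc (Suc n)\<close> is the weaker of the two and serves
    both parities.\<close>
  have "\<forall>\<^sub>F n in sequentially. inverse (real (Suc (Suc n))) \<le> norm (f (x (Suc n)) - f (x n)) powr p"
    using cg eventually_compose_filterlim[OF cg filterlim_Suc]
  proof eventually_elim
    case (elim n)
    have "inverse (real (Suc (Suc n))) \<le> inverse (real (Suc n))"
      by (intro le_imp_inverse_le) auto
    with elim(1) have "inverse (real (Suc (Suc n))) \<le> c (g n)"
      by (rule order_trans[rotated])
    then show ?case
      using elim(2) by (cases "even n") (simp_all add: x_def c_def norm_minus_commute)
  qed
  then have "summable (\<lambda>n. inverse (real (Suc (Suc n))))"
    by (intro summable_comparison_test_ev[OF _ summ]) simp
  then have "summable (\<lambda>n. inverse (real n))"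
    using summable_Suc_iff[of "\<lambda>n. inverse (real n)"]
      summable_Suc_iff[of "\<lambda>n. inverse (real (Suc n))"] by blast
  then show False
    using not_summable_harmonic by blast
qed

text \<open>At most \<open>N\<close> increments are nonzero and each has norm at most
  \<open>2 * \<eta>\<close>; the summand 1 accounts for the initial entry.\<close>

lemma bv_norm_finite_support_le:
  assumes p: "1 \<le> p" and supp: "\<And>n. N \<le> n \<Longrightarrow> d n = 0"
    and le: "\<And>n. norm (d n) \<le> \<eta>"
  shows "bv_norm p d \<le> \<eta> * (1 + 2 * real N powr (1 / p))"
proof -
  have \<eta>: "0 \<le> \<eta>"
    using le norm_ge_zero order_trans by blast
  have step: "norm (d (Suc n) - d n) powr p \<le> (2 * \<eta>) powr p" for n
    using norm_triangle_ineq4[of "d (Suc n)" "d n"] le[of n] le[of "Suc n"] p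
    by (intro powr_mono2) auto
  \<comment> \<open>The drop from \<open>d (N - 1)\<close> to 0 is the last increment that can
    survive, and it has index below \<open>N\<close>.\<close>
  have sum_eq: "(\<Sum>n. norm (d (Suc n) - d n) powr p) = (\<Sum>n<N. norm (d (Suc n) - d n) powr p)"
    using supp p by (intro suminf_finite) auto
  also have "\<dots> \<le> real N * (2 * \<eta>) powr p"
    using sum_bounded_above[where A = "{..<N}", OF step] by simp
  finally have "(\<Sum>n. norm (d (Suc n) - d n) powr p) powr (1 / p)
      \<le> (real N * (2 * \<eta>) powr p) powr (1 / p)"
    using sum_eq p by (intro powr_mono2) (auto intro: sum_nonneg)
  also have "\<dots> = real N powr (1 / p) * (2 * \<eta>)"
    using \<eta> p by (simp add: powr_mult powr_powr)
  finally show ?thesis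
    using le[of 0] by (simp add: bv_norm_def algebra_simps)
qed

theorem theorem9:
  fixes f :: "'a::real_normed_vector \<Rightarrow> 'a" and p :: real
  assumes "1 \<le> p"
    and "comp_op f \<in> c_zero \<rightarrow> bv_space p"
  shows "continuous_map c_zero_topology (bv_topology p) (comp_op f) \<longleftrightarrow> continuous_on UNIV f"
proof -
  have bv: "comp_op f x \<in> bv_space p" if "x \<in> c_zero" for x
    using assms(2) that by auto
  have "continuous_map c_zero_topology (bv_topology p) (comp_op f) \<longleftrightarrow>
    (\<forall>x\<in>c_zero. \<forall>\<epsilon>>0. \<exists>\<delta>>0. \<forall>y. y \<in> c_zero \<and> norm_dist c_zero sup_norm x y < \<delta> \<longrightarrow>
      norm_dist (bv_space p) (bv_norm p) (comp_op f x) (comp_op f y) < \<epsilon>)"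
    unfolding c_zero_topology_def bv_topology_def
      Metric_space.metric_continuous_map[OF Metric_space_c_zero Metric_space_bv_space[OF assms(1)]]
    using bv by blast
  also have "\<dots> \<longleftrightarrow> (\<forall>x\<in>c_zero. \<forall>\<epsilon>>0. \<exists>\<delta>>0. \<forall>y\<in>c_zero. sup_norm (\<lambda>n. x n - y n) < \<delta> \<longrightarrow>
      bv_norm p (\<lambda>n. f (x n) - f (y n)) < \<epsilon>)" (is "_ \<longleftrightarrow> ?C")
  proof -
    \<comment> \<open>Both images lie in \<open>bv_space p\<close>, so the default value 0 of
      \<open>norm_dist\<close> does not occur here.\<close>
    have "norm_dist (bv_space p) (bv_norm p) (comp_op f x) (comp_op f y)
        = bv_norm p (\<lambda>n. f (x n) - f (y n))" if "x \<in> c_zero" "y \<in> c_zero" for x y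
      using bv that by (simp add: norm_dist_def comp_op_def)
    then show ?thesis
      by (auto simp: norm_dist_def Ball_def)
  qed
  also have "\<dots> \<longleftrightarrow> continuous_on UNIV f"
  proof
    assume C: ?C
    define e where "e u n = (if n = 0 then u else 0)" for u :: 'a and n :: nat
    have e: "e u \<in> c_zero" for u
      unfolding c_zero_def e_def
      by (auto intro!: tendsto_eventually eventually_mono[OF eventually_gt_at_top[of 0]])
    have sup_e: "sup_norm (\<lambda>n. e u n - e v n) = norm (u - v)" for u v
      unfolding sup_norm_def by (rule cSup_eq_maximum) (auto simp: e_def)
    \<comment> \<open>The initial entry alone contributes \<open>norm (f u - f v)\<close> to the
      norm.\<close>
    have f_le: "norm (f u - f v) \<le> bv_norm p (\<lambda>n. f (e u n) - f (e v n))" for u v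
      by (simp add: bv_norm_def e_def)
    show "continuous_on UNIV f"
      unfolding continuous_on_iff
    proof (intro ballI allI impI)
      fix u :: 'a and \<epsilon> :: real
      assume "0 < \<epsilon>"
      then obtain \<delta> where "0 < \<delta>"
        and \<delta>: "\<And>y. y \<in> c_zero \<Longrightarrow> sup_norm (\<lambda>n. e u n - y n) < \<delta> \<Longrightarrow>
          bv_norm p (\<lambda>n. f (e u n) - f (y n)) < \<epsilon>"
        using C e by blast
      have "dist (f v) (f u) < \<epsilon>" if "dist v u < \<delta>" for v
        using \<delta>[OF e, of v] f_le[of u v] that
        by (simp add: sup_e dist_norm norm_minus_commute)
      then show "\<exists>\<delta>>0. \<forall>v\<in>UNIV. dist v u < \<delta> \<longrightarrow> dist (f v) (f u) < \<epsilon>"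
        using \<open>0 < \<delta>\<close> by blast
    qed
  next
    assume cont: "continuous_on UNIV f"
    obtain r where r: "0 < r" "\<And>u. norm u < r \<Longrightarrow> f u = f 0"
      using comp_op_bv_space_imp_locally_constant[OF assms(2)] by blast
    show ?C
    proof (intro ballI allI impI)
      fix x :: "nat \<Rightarrow> 'a" and \<epsilon> :: real
      assume x: "x \<in> c_zero" and "0 < \<epsilon>"
      \<comment> \<open>Half the radius leaves room for \<open>y\<close>: together with
        \<open>\<delta> < r / 2\<close> it puts \<open>y n\<close> in the ball of radius
        \<open>r\<close> too.\<close>
      obtain N where N: "\<And>n. N \<le> n \<Longrightarrow> norm (x n) < r / 2"
        using x r(1) LIMSEQ_D[of x 0 "r / 2"] by (auto simp: c_zero_def)
      define K where "K = 1 + 2 * real N powr (1 / p)"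
      \<comment> \<open>This makes the final bound \<open>\<eta> * K\<close> equal to
        \<open>\<epsilon> / 2\<close>.\<close>
      define \<eta> where "\<eta> = \<epsilon> / (2 * K)"
      have "0 < K"
        unfolding K_def by (intro add_pos_nonneg) auto
      then have "0 < \<eta>"
        using \<open>0 < \<epsilon>\<close> by (simp add: \<eta>_def)
      \<comment> \<open>Phrased for all small positive \<open>\<delta>\<close>, the conditions at
        the finitely many points \<open>x n\<close> with \<open>n < N\<close> can be intersected
        without forming a minimum.\<close>
      have "\<forall>\<^sub>F \<delta> in at_right 0. \<forall>v. dist v u < \<delta> \<longrightarrow> dist (f v) (f u) < \<eta>" for u
      proof -
        obtain \<delta> where "0 < \<delta>" "\<And>v. dist v u < \<delta> \<Longrightarrow> dist (f v) (f u) < \<eta>"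
          using cont \<open>0 < \<eta>\<close> unfolding continuous_on_iff by blast
        then show ?thesis
          unfolding eventually_at_right_field by (intro exI[of _ \<delta>]) force
      qed
      then have "\<forall>\<^sub>F \<delta> in at_right 0. \<forall>n\<in>{..<N}. \<forall>v. dist v (x n) < \<delta> \<longrightarrow> dist (f v) (f (x n)) < \<eta>"
        by (intro eventually_ball_finite) auto
      moreover have "\<forall>\<^sub>F \<delta> in at_right 0. \<delta> \<in> {0<..<r / 2}"
        using r(1) by (intro eventually_at_right_real) auto
      ultimately have "\<forall>\<^sub>F \<delta> in at_right 0. \<delta> \<in> {0<..<r / 2} \<and>
          (\<forall>n\<in>{..<N}. \<forall>v. dist v (x n) < \<delta> \<longrightarrow> dist (f v) (f (x n)) < \<eta>)"
        by eventually_elim blast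
      from eventually_happens'[OF trivial_limit_at_right_real this]
      obtain \<delta> where \<delta>: "0 < \<delta>" "\<delta> < r / 2"
        and f\<delta>: "\<And>n v. n < N \<Longrightarrow> dist v (x n) < \<delta> \<Longrightarrow> dist (f v) (f (x n)) < \<eta>"
        unfolding greaterThanLessThan_iff lessThan_iff Ball_def by blast
      have "bv_norm p (\<lambda>n. f (x n) - f (y n)) < \<epsilon>"
        if y: "y \<in> c_zero" and xy: "sup_norm (\<lambda>n. x n - y n) < \<delta>" for y
      proof -
        have "(\<lambda>n. x n - y n) \<in> c_zero"
          using x y tendsto_diff[of x 0 sequentially y 0] by (simp add: c_zero_def)
        from norm_le_sup_norm[OF this] have close: "norm (x n - y n) < \<delta>" for n
          using xy by (rule le_less_trans)
        have supp: "f (x n) - f (y n) = 0" if "N \<le> n" for n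
        proof -
          have "norm (y n) < r"
            using norm_triangle_sub[of "y n" "x n"] N[OF that] close[of n] \<delta>(2)
            by (simp add: norm_minus_commute)
          moreover have "norm (x n) < r"
            using N[OF that] r(1) by simp
          ultimately show ?thesis
            using r(2) by simp
        qed
        have "norm (f (x n) - f (y n)) \<le> \<eta>" for n
        proof (cases "n < N")
          case True
          then show ?thesis
            using f\<delta>[of n "y n"] close[of n] by (simp add: dist_norm norm_minus_commute)
        next
          case False
          then show ?thesis
            using supp[of n] \<open>0 < \<eta>\<close> by simp
        qed
        from bv_norm_finite_support_le[where d = "\<lambda>n. f (x n) - f (y n)", OF assms(1) supp this]
        have "bv_norm p (\<lambda>n. f (x n) - f (y n)) \<le> \<eta> * K"
          by (simp add: K_def)
        also have "\<dots> < \<epsilon>"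
          using \<open>0 < K\<close> \<open>0 < \<epsilon>\<close> by (simp add: \<eta>_def)
        finally show ?thesis .
      qed
      then show "\<exists>\<delta>>0. \<forall>y\<in>c_zero. sup_norm (\<lambda>n. x n - y n) < \<delta> \<longrightarrow>
          bv_norm p (\<lambda>n. f (x n) - f (y n)) < \<epsilon>"
        using \<delta>(1) by blast
    qed
  qed
  finally show ?thesis .
qed

end
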